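(* Let $\mathcal{C}_{in}$ be the binary extended Golay code with parameters $[24,12,8]_2$, which has locality $7$. Let $\{\mathcal{C}_{out}^{(i)}\}_{i=1}^\infty$ be a family of algebraic geometry codes over $\mathbb{F}_{2^{12}}$ with parameters $[n_i,k_i,d_i]_{2^{12}}$ attaining the Tsfasman–Vlăduţ–Zink bound, i.e. $n_i\to\infty$, the limits $R_{out}=\lim k_i/n_i$ and $\delta_{out}=\lim d_i/n_i$ exist, and $R_{out}\ge 1-\frac{1}{2^6-1}-\delta_{out}$. Then the concatenated codes (inner code $\mathcal{C}_{in}$, outer codes $\mathcal{C}_{out}^{(i)}$) form a family of $[24n_i,12k_i,\ge 8d_i;7]_2$-locally repairable codes with locality $7$ whose information rate $R$ and relative minimum distance $\delta$ satisfy $$R\ge \tfrac{31}{63}-\tfrac{3}{2}\delta .$$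
   Context: An $[n,k,d]_q$-linear code is a $k$-dimensional subspace of $\mathbb{F}_q^n$ with minimum Hamming distance $d$ ($\ge d$: at least $d$). It has locality $r$ if for every coordinate $i$ there is a set $R\subseteq[n]\setminus\{i\}$, $|R|\le r$, such that codewords agreeing on $R$ also agree at $i$; equivalently, every coordinate $i$ lies in the support of some dual codeword of weight at most $r+1$. An $[n,k,d;r]_q$-locally repairable code is an $[n,k,d]_q$-linear code with locality $r$. Concatenation: for an inner $[n_1,k_1,d_1]_q$ code $\mathcal{C}_{in}$ and outer code $\mathcal{C}_{out}\subseteq\mathbb{F}_{q^{k_1}}^{n_2}$, fix an $\mathbb{F}_q$-linear isomorphism $\varphi:\mathbb{F}_{q^{k_1}}\to\mathcal{C}_{in}$; the concatenated code is $\{(\varphi(c_1),\dots,\varphi(c_{n_2})):(c_1,\dots,c_{n_2})\in\mathcal{C}_{out}\}$. Algebraic geometry code: for a function field $F/\mathbb{F}_Q$ with full constant field $\mathbb{F}_Q$, distinct rational places $P_1,\dots,P_n$ and a divisor $G$ with $0<\deg G<n$ whose support contains no $P_j$, it is $\{(f(P_1),\dots,f(P_n)):f\in\mathcal{L}(G)\}$, where $\mathcal{L}(G)$ is the Riemann–Roch space. For a family of codes of lengths $N_i\to\infty$, dimensions $K_i$ and minimum distances $D_i$, the information rate is $R=\lim K_i/N_i$ and the relative minimum distance is $\delta=\liminf D_i/N_i$. *)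

theory Defs
  imports
    Complex_Main
    "HOL-Library.Cardinality"
    "HOL-Library.Z2"
    "HOL-Library.Function_Algebras"
    "HOL-Library.Liminf_Limsup"
    "HOL-Library.Extended_Real"
    "HOL-Computational_Algebra.Polynomial"
    "HOL-Algebra.QuotRing"
    "HOL-Algebra.Generated_Fields"
    "HOL-Algebra.Finite_Extensions"
begin

section \<open>Linear codes\<close>

text \<open>
  A word of length n over a finite field is a function \<open>nat \<Rightarrow> 'a\<close> that vanishes at all
  positions \<open>\<ge> n\<close>; the coordinates are \<open>0, \<dots>, n - 1\<close>.  This realises the coordinate spaces of
  all lengths inside one vector space, whose dimension function is \<open>word.dim\<close>.
\<close>

definition wscale :: "'a::field \<Rightarrow> (nat \<Rightarrow> 'a) \<Rightarrow> (nat \<Rightarrow> 'a)" where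
  "wscale a x = (\<lambda>j. a * x j)"

global_interpretation word: vector_space "wscale :: 'a::field \<Rightarrow> (nat \<Rightarrow> 'a) \<Rightarrow> (nat \<Rightarrow> 'a)"
  by unfold_locales (auto simp: wscale_def fun_eq_iff algebra_simps)

definition words :: "nat \<Rightarrow> (nat \<Rightarrow> 'a::field) set" where
  "words n = {x. \<forall>j\<ge>n. x j = 0}"

definition hamming_dist :: "nat \<Rightarrow> (nat \<Rightarrow> 'a::field) \<Rightarrow> (nat \<Rightarrow> 'a) \<Rightarrow> nat" where
  "hamming_dist n x y = card {j. j < n \<and> x j \<noteq> y j}"

text \<open>Meaningful only for codes with at least two words; \<open>is_code\<close> below requires this.\<close>

definition min_dist :: "nat \<Rightarrow> (nat \<Rightarrow> 'a::field) set \<Rightarrow> nat" where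
  "min_dist n C = Inf {hamming_dist n x y | x y. x \<in> C \<and> y \<in> C \<and> x \<noteq> y}"

definition is_code :: "nat \<Rightarrow> nat \<Rightarrow> nat \<Rightarrow> (nat \<Rightarrow> 'a::field) set \<Rightarrow> bool" where
  "is_code n k d C \<longleftrightarrow>
     C \<subseteq> words n \<and> word.subspace C \<and> C \<noteq> {0} \<and> word.dim C = k \<and> min_dist n C = d"

definition has_locality :: "nat \<Rightarrow> nat \<Rightarrow> (nat \<Rightarrow> 'a::field) set \<Rightarrow> bool" where
  "has_locality n r C \<longleftrightarrow>
     (\<forall>i<n. \<exists>R. R \<subseteq> {..<n} - {i} \<and> card R \<le> r \<and>
        (\<forall>x\<in>C. \<forall>y\<in>C. (\<forall>j\<in>R. x j = y j) \<longrightarrow> x i = y i))"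

definition is_lrc :: "nat \<Rightarrow> nat \<Rightarrow> nat \<Rightarrow> nat \<Rightarrow> (nat \<Rightarrow> 'a::field) set \<Rightarrow> bool" where
  "is_lrc n k d r C \<longleftrightarrow> is_code n k d C \<and> has_locality n r C"

definition has_information_rate :: "(nat \<Rightarrow> nat) \<Rightarrow> (nat \<Rightarrow> (nat \<Rightarrow> 'a::field) set) \<Rightarrow> real \<Rightarrow> bool" where
  "has_information_rate N C R \<longleftrightarrow> (\<lambda>i. real (word.dim (C i)) / real (N i)) \<longlonglongrightarrow> R"

definition has_relative_min_dist :: "(nat \<Rightarrow> nat) \<Rightarrow> (nat \<Rightarrow> (nat \<Rightarrow> 'a::field) set) \<Rightarrow> real \<Rightarrow> bool" where
  "has_relative_min_dist N C \<delta> \<longleftrightarrow>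
     liminf (\<lambda>i. ereal (real (min_dist (N i) (C i)) / real (N i))) = ereal \<delta>"


section \<open>The binary extended Golay code\<close>

text \<open>
  The cyclic Golay code of length 23 is generated by
  \<open>x^11 + x^10 + x^6 + x^5 + x^4 + x^2 + 1\<close>, a divisor of \<open>x^23 - 1\<close> over the field with two
  elements; coordinate 23 is the overall parity check.
\<close>

definition golay_gen_poly :: "bit poly" where
  "golay_gen_poly = [:1, 0, 1, 0, 1, 1, 1, 0, 0, 0, 1, 1:]"

definition extended_golay :: "(nat \<Rightarrow> bit) set" where
  "extended_golay =
     {x \<in> words 24. golay_gen_poly dvd (\<Sum>j<23. Polynomial.monom (x j) j) \<and> (\<Sum>j<24. x j) = 0}"


section \<open>Concatenation\<close>

definition field_ring :: "'a::field ring" where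
  "field_ring = \<lparr>carrier = UNIV, mult = (*), one = 1, zero = 0, add = (+)\<rparr>"

text \<open>
  The big field \<open>'k\<close> is a vector space over the small field \<open>'b\<close> via the field embedding \<open>e\<close>.
\<close>

definition linear_iso_onto :: "('b::field \<Rightarrow> 'k::field) \<Rightarrow> ('k \<Rightarrow> (nat \<Rightarrow> 'b)) \<Rightarrow> (nat \<Rightarrow> 'b) set \<Rightarrow> bool" where
  "linear_iso_onto e \<phi> C \<longleftrightarrow>
     Vector_Spaces.linear (\<lambda>a x. e a * x) wscale \<phi> \<and> bij_betw \<phi> UNIV C"

text \<open>
  Block \<open>i\<close> of a concatenated word consists of the positions \<open>m * i, \<dots>, m * i + m - 1\<close>, where
  \<open>m\<close> is the length of the inner code.  The word vanishes beyond its length because \<open>\<phi> 0 = 0\<close>.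
\<close>

definition concat_code ::
    "nat \<Rightarrow> ('k::field \<Rightarrow> (nat \<Rightarrow> 'b::field)) \<Rightarrow> (nat \<Rightarrow> 'k) set \<Rightarrow> (nat \<Rightarrow> 'b) set" where
  "concat_code m \<phi> C = (\<lambda>c j. \<phi> (c (j div m)) (j mod m)) ` C"


section \<open>Algebraic function fields\<close>

text \<open>
  The members of a family of function fields differ, so they are record-based fields with
  a carrier; \<open>K\<close> is a subfield of \<open>F\<close>.
\<close>

definition function_field :: "'f ring \<Rightarrow> 'f set \<Rightarrow> bool" where
  "function_field F K \<longleftrightarrow>
     Ring.field F \<and> subfield K F \<and>
     (\<exists>x\<in>carrier F. ring.transcendental F K x \<and>
        ring.finite_dimension F (generate_field F (K \<union> {x})) (carrier F))"

definition full_constant_field :: "'f ring \<Rightarrow> 'f set \<Rightarrow> bool" where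
  "full_constant_field F K \<longleftrightarrow> K = {x \<in> carrier F. ring.algebraic F K x}"

definition valuation_ring :: "'f ring \<Rightarrow> 'f set \<Rightarrow> 'f set \<Rightarrow> bool" where
  "valuation_ring F K A \<longleftrightarrow>
     subring A F \<and> K \<subset> A \<and> A \<subset> carrier F \<and>
     (\<forall>z\<in>carrier F - {\<zero>\<^bsub>F\<^esub>}. z \<in> A \<or> inv\<^bsub>F\<^esub> z \<in> A)"

text \<open>A place is the maximal ideal of a valuation ring.\<close>

definition places :: "'f ring \<Rightarrow> 'f set \<Rightarrow> 'f set set" where
  "places F K = {P. \<exists>A. valuation_ring F K A \<and> maximalideal P (F\<lparr>carrier := A\<rparr>)}"

text \<open>A place \<open>P\<close> determines its valuation ring, as the set of all \<open>z\<close> with \<open>z = 0\<close> or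
  \<open>1 / z\<close> not in \<open>P\<close>.\<close>

definition place_ring :: "'f ring \<Rightarrow> 'f set \<Rightarrow> 'f ring" where
  "place_ring F P = F\<lparr>carrier := {z \<in> carrier F. z = \<zero>\<^bsub>F\<^esub> \<or> inv\<^bsub>F\<^esub> z \<notin> P}\<rparr>"

text \<open>The normalised discrete valuation of a nonzero element: the exponent \<open>m\<close> in \<open>z = u t^m\<close>,
  where \<open>t\<close> is a generator of \<open>P\<close> and \<open>u\<close> a unit of the valuation ring.\<close>

definition place_val :: "'f ring \<Rightarrow> 'f set \<Rightarrow> 'f \<Rightarrow> int" where
  "place_val F P z =
     (THE m. \<exists>t\<in>carrier (place_ring F P). \<exists>u\<in>Units (place_ring F P).
        P = PIdl\<^bsub>place_ring F P\<^esub> t \<and> z = u \<otimes>\<^bsub>F\<^esub> t [^]\<^bsub>F\<^esub> m)"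

text \<open>The degree is the dimension of the residue field over the image of \<open>K\<close> in it.\<close>

definition place_deg :: "'f ring \<Rightarrow> 'f set \<Rightarrow> 'f set \<Rightarrow> nat" where
  "place_deg F K P =
     (let S = place_ring F P Quot P
      in ring.dim S ((\<lambda>a. P +>\<^bsub>place_ring F P\<^esub> a) ` K) (carrier S))"

definition rational_places :: "'f ring \<Rightarrow> 'f set \<Rightarrow> 'f set set" where
  "rational_places F K = {P \<in> places F K. place_deg F K P = 1}"

definition is_divisor :: "'f ring \<Rightarrow> 'f set \<Rightarrow> ('f set \<Rightarrow> int) \<Rightarrow> bool" where
  "is_divisor F K G \<longleftrightarrow> finite {P. G P \<noteq> 0} \<and> {P. G P \<noteq> 0} \<subseteq> places F K"

definition divisor_deg :: "'f ring \<Rightarrow> 'f set \<Rightarrow> ('f set \<Rightarrow> int) \<Rightarrow> int" where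
  "divisor_deg F K G = (\<Sum>P | G P \<noteq> 0. G P * int (place_deg F K P))"

definition riemann_roch_space :: "'f ring \<Rightarrow> 'f set \<Rightarrow> ('f set \<Rightarrow> int) \<Rightarrow> 'f set" where
  "riemann_roch_space F K G =
     {f \<in> carrier F. f = \<zero>\<^bsub>F\<^esub> \<or> (\<forall>P\<in>places F K. place_val F P f \<ge> - G P)}"


section \<open>Algebraic geometry codes\<close>

text \<open>
  The alphabet \<open>'k\<close> is identified with the constant field of \<open>F\<close> by the embedding \<open>\<iota>\<close>.  At a
  rational place the value of \<open>f\<close> is the unique constant in the same residue class.
\<close>

definition place_eval :: "'f ring \<Rightarrow> ('k::field \<Rightarrow> 'f) \<Rightarrow> 'f set \<Rightarrow> 'f \<Rightarrow> 'k" where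
  "place_eval F \<iota> P f = (THE a. f \<ominus>\<^bsub>F\<^esub> \<iota> a \<in> P)"

definition ag_code_data ::
    "'f ring \<Rightarrow> ('k::field \<Rightarrow> 'f) \<Rightarrow> nat \<Rightarrow> (nat \<Rightarrow> 'f set) \<Rightarrow> ('f set \<Rightarrow> int) \<Rightarrow> bool" where
  "ag_code_data F \<iota> n P G \<longleftrightarrow>
     \<iota> \<in> ring_hom field_ring F \<and>
     function_field F (range \<iota>) \<and> full_constant_field F (range \<iota>) \<and>
     P ` {..<n} \<subseteq> rational_places F (range \<iota>) \<and> inj_on P {..<n} \<and>
     is_divisor F (range \<iota>) G \<and>
     0 < divisor_deg F (range \<iota>) G \<and> divisor_deg F (range \<iota>) G < int n \<and>
     (\<forall>j<n. G (P j) = 0)"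

definition ag_code ::
    "'f ring \<Rightarrow> ('k::field \<Rightarrow> 'f) \<Rightarrow> nat \<Rightarrow> (nat \<Rightarrow> 'f set) \<Rightarrow> ('f set \<Rightarrow> int) \<Rightarrow> (nat \<Rightarrow> 'k) set" where
  "ag_code F \<iota> n P G =
     (\<lambda>f j. if j < n then place_eval F \<iota> (P j) f else 0) ` riemann_roch_space F (range \<iota>) G"

end

theory Submission
  imports Defs
begin

text \<open>The extended Golay code is spanned by the twelve shifts of the generator polynomial, each
  completed by a parity bit, and inspection of the \<open>2^12\<close> sums of these rows shows that its minimum
  weight is 8.  The rows have weight 8, are pairwise orthogonal (also to themselves) and their
  supports cover all coordinates; being dual codewords, they give locality 7.

  Under concatenation each repair set is shifted into its block, and every position at which two
  outer words differ contributes at least 8 to the distance.  Hence \<open>R = R_out / 2\<close> and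
  \<open>\<delta> \<ge> \<delta>_out / 3\<close>, so that \<open>R \<ge> (62/63 - \<delta>_out) / 2 \<ge> 31/63 - 3/2 * \<delta>\<close>.\<close>

section \<open>Linear codes over finite fields\<close>

lemma sum_apply: "(\<Sum>i\<in>I. f i) j = (\<Sum>i\<in>I. f i j)"
  by (induction I rule: infinite_finite_induct) simp_all

lemma subspace_words: "word.subspace (words n)"
  by (auto simp: word.subspace_def words_def wscale_def)

section \<open>Cardinality and dimension of spaces of words\<close>

lemma finite_words: "finite (words n :: (nat \<Rightarrow> 'a::{field,finite}) set)"
proof (rule finite_subset)
  show "words n \<subseteq> (\<lambda>f j. if j < n then f j else 0) ` PiE {..<n} (\<lambda>_. UNIV :: 'a set)"
  proof
    fix x :: "nat \<Rightarrow> 'a" assume "x \<in> words n"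
    then have "x = (\<lambda>j. if j < n then restrict x {..<n} j else 0)"
      by (auto simp: words_def fun_eq_iff)
    then show "x \<in> (\<lambda>f j. if j < n then f j else 0) ` PiE {..<n} (\<lambda>_. UNIV :: 'a set)"
      by (rule image_eqI[where f = "\<lambda>f j. if j < n then f j else 0"])
        (simp add: restrict_PiE_iff del: restrict_apply)
  qed
qed (simp add: finite_PiE)

text \<open>Each new basis vector \<open>b\<close> multiplies the number of words by
  \<open>CARD('a)\<close>: every word of the larger span is uniquely \<open>wscale a b + x\<close>
  with \<open>x\<close> in the old span.\<close>

lemma card_span_independent:
  fixes B :: "(nat \<Rightarrow> 'a::{field,finite}) set"
  assumes "finite B" "word.independent B"
  shows "card (word.span B) = CARD('a) ^ card B"
  using assms
proof (induction B)
  case (insert b B)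
  have b: "b \<notin> word.span B" and ind: "word.independent B"
    using insert.prems insert.hyps by (auto simp: word.independent_insert)
  let ?f = "\<lambda>(a, x). wscale a b + x"
  have "inj_on ?f (UNIV \<times> word.span B)"
  proof (rule inj_onI, clarify)
    fix a a' x x'
    assume *: "x \<in> word.span B" "x' \<in> word.span B" "wscale a b + x = wscale a' b + x'"
    have "wscale (a - a') b = x' - x"
      using *(3) by (simp add: algebra_simps)
    \<comment> \<open>If \<open>a\<close> and \<open>a'\<close> differed, dividing by
      \<open>a - a'\<close> would put \<open>b\<close> itself into the old span.\<close>
    then have "wscale (a - a') b \<in> word.span B"
      using * by (simp add: word.span_diff)
    moreover have "b = wscale (inverse (a - a')) (wscale (a - a') b)" if "a \<noteq> a'"
      using that by simp
    ultimately have "a = a'" using b word.span_scale by metis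
    then show "a = a' \<and> x = x'" using * by simp
  qed
  moreover have "?f ` (UNIV \<times> word.span B) = word.span (insert b B)"
  proof (intro equalityI subsetI)
    fix x assume "x \<in> ?f ` (UNIV \<times> word.span B)"
    then obtain a y where "x = wscale a b + y" "y \<in> word.span B" by auto
    then show "x \<in> word.span (insert b B)"
      unfolding word.span_breakdown_eq by (intro exI[of _ a]) simp
  next
    fix x assume "x \<in> word.span (insert b B)"
    then obtain a where "x - wscale a b \<in> word.span B"
      by (auto simp: word.span_breakdown_eq)
    then show "x \<in> ?f ` (UNIV \<times> word.span B)"
      by (intro image_eqI[of _ _ "(a, x - wscale a b)"]) auto
  qed
  ultimately have "card (word.span (insert b B)) = CARD('a) * card (word.span B)"
    by (metis card_image card_cartesian_product)
  then show ?case using insert ind by simp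
qed simp

text \<open>Dimensions over two different fields become comparable through cardinalities, without
  building a basis of the concatenated code.\<close>

lemma card_subspace:
  fixes S :: "(nat \<Rightarrow> 'a::{field,finite}) set"
  assumes "word.subspace S" "finite S"
  shows "card S = CARD('a) ^ word.dim S"
proof -
  obtain B where B: "B \<subseteq> S" "word.independent B" "S \<subseteq> word.span B" "card B = word.dim S"
    using word.basis_exists .
  moreover have "word.span B = S"
    using B assms(1) by (simp add: word.span_minimal subset_antisym)
  ultimately show ?thesis
    using card_span_independent[of B] finite_subset[OF B(1) assms(2)] by simp
qed

text \<open>The induction adds a new least index \<open>b\<close>. All rows of larger index vanish
  at \<open>b\<close>, and so does their span, whereas \<open>r b\<close> does not.\<close>

lemma independent_triangular:
  fixes r :: "nat \<Rightarrow> nat \<Rightarrow> 'a::field"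
  assumes "finite I" "\<And>i. i \<in> I \<Longrightarrow> r i i \<noteq> 0"
    and "\<And>i k. \<lbrakk>i \<in> I; k \<in> I; i < k\<rbrakk> \<Longrightarrow> r k i = 0"
  shows "word.independent (r ` I) \<and> inj_on r I"
  using assms
proof (induction I rule: finite_linorder_min_induct)
  case (insert b A)
  have "word.span (r ` A) \<subseteq> {x. x b = 0}"
    using insert.hyps insert.prems
    by (intro word.span_minimal) (auto simp: word.subspace_def wscale_def)
  then have b: "r b \<notin> word.span (r ` A)"
    using insert.prems(1)[of b] by auto
  then have "r b \<notin> r ` A"
    using word.span_base by blast
  moreover have "word.independent (r ` A) \<and> inj_on r A"
    using insert by simp
  ultimately show ?case
    using b insert.hyps by (auto simp: word.independent_insert)
qed (simp add: word.independent_empty)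

section \<open>Hamming distance, minimum distance and locality\<close>

lemma hamming_dist_le: "hamming_dist n x y \<le> n"
  unfolding hamming_dist_def using card_mono[of "{..<n}" "{j. j < n \<and> x j \<noteq> y j}"] by auto

lemma hamming_dist_eq_sum: "hamming_dist n x y = (\<Sum>j<n. of_bool (x j \<noteq> y j))"
  by (simp add: hamming_dist_def Int_def)

lemma hamming_dist_diff: "hamming_dist n (x - y) 0 = hamming_dist n x y"
  by (simp add: hamming_dist_def)

lemma min_dist_le_hamming_dist:
  "\<lbrakk>x \<in> C; y \<in> C; x \<noteq> y\<rbrakk> \<Longrightarrow> min_dist n C \<le> hamming_dist n x y"
  unfolding min_dist_def by (rule wellorder_Inf_le1) blast

text \<open>The pair of distinct words guarantees that the infimum is taken over a nonempty
  set.\<close>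

lemma le_min_dist:
  assumes "x \<in> C" "y \<in> C" "x \<noteq> y"
    and "\<And>x y. \<lbrakk>x \<in> C; y \<in> C; x \<noteq> y\<rbrakk> \<Longrightarrow> D \<le> hamming_dist n x y"
  shows "D \<le> min_dist n C"
  unfolding min_dist_def using assms by (intro cInf_greatest) blast+

lemma subspace_nontrivialE:
  assumes "word.subspace C" "C \<noteq> {0}"
  obtains x where "x \<in> C" "x \<noteq> 0" "0 \<in> C"
  using assms word.subspace_0 by blast

text \<open>Bounds the relative minimum distance by 1, which later keeps its liminf finite.\<close>

lemma min_dist_le_length:
  assumes "is_code n k d C"
  shows "d \<le> n"
proof -
  obtain x where "x \<in> C" "x \<noteq> 0" "0 \<in> C"
    using assms subspace_nontrivialE unfolding is_code_def by metis
  then show ?thesis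
    using assms min_dist_le_hamming_dist[of x C 0 n] hamming_dist_le[of n x 0]
    by (simp add: is_code_def)
qed

text \<open>A coordinate in the support of a dual codeword \<open>w\<close> is recovered from the rest of that
  support.\<close>

lemma has_localityI_dual:
  fixes C :: "(nat \<Rightarrow> 'a::field) set"
  assumes "\<And>i. i < n \<Longrightarrow> \<exists>w. w i \<noteq> 0 \<and> card {j. j < n \<and> w j \<noteq> 0} \<le> Suc r \<and>
                              (\<forall>x\<in>C. (\<Sum>j<n. w j * x j) = 0)"
  shows "has_locality n r C"
  unfolding has_locality_def
proof (intro allI impI)
  fix i assume i: "i < n"
  then obtain w where w: "w i \<noteq> 0" "card {j. j < n \<and> w j \<noteq> 0} \<le> Suc r"
    "\<And>x. x \<in> C \<Longrightarrow> (\<Sum>j<n. w j * x j) = 0"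
    using assms by blast
  let ?R = "{j. j < n \<and> w j \<noteq> 0} - {i}"
  have "x i = y i" if "x \<in> C" "y \<in> C" "\<forall>j\<in>?R. x j = y j" for x y
  proof -
    have "(\<Sum>j<n. w j * (x j - y j)) = 0"
      using that w(3) by (simp add: right_diff_distrib sum_subtractf)
    \<comment> \<open>Outside \<open>?R\<close> and \<open>i\<close> the factor \<open>w j\<close>
      is zero, and on \<open>?R\<close> the words agree, so only the term at \<open>i\<close>
      survives.\<close>
    moreover have "(\<Sum>j<n. w j * (x j - y j)) = (\<Sum>j\<in>{i}. w j * (x j - y j))"
      using i that(3) by (intro sum.mono_neutral_right) auto
    ultimately show ?thesis using w(1) by simp
  qed
  moreover have "card ?R \<le> r" using w i by simp
  ultimately show "\<exists>R\<subseteq>{..<n} - {i}. card R \<le> r \<and>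
      (\<forall>x\<in>C. \<forall>y\<in>C. (\<forall>j\<in>R. x j = y j) \<longrightarrow> x i = y i)"
    by (intro exI[of _ ?R]) auto
qed

section \<open>The extended Golay code\<close>

text \<open>The shifts \<open>X^i * g\<close> of the generator polynomial, each completed by the parity bit 1
  since \<open>g\<close> has seven nonzero coefficients.\<close>

definition golay_row :: "nat \<Rightarrow> nat \<Rightarrow> bit" where
  "golay_row i j = (if j < 23 \<and> i \<le> j then poly.coeff golay_gen_poly (j - i) else of_bool (j = 23))"

lemma degree_golay_gen_poly: "Polynomial.degree golay_gen_poly = 11"
  by (simp add: golay_gen_poly_def)

lemma subspace_extended_golay: "word.subspace extended_golay"
proof -
  have 1: "(\<Sum>j<23. Polynomial.monom ((x + y) j) j) =
      (\<Sum>j<23. Polynomial.monom (x j) j) + (\<Sum>j<23. Polynomial.monom (y j) j)" for x y :: "nat \<Rightarrow> bit"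
    by (simp only: plus_fun_apply add_monom[symmetric] sum.distrib)
  have 2: "(\<Sum>j<24. (x + y) j) = (\<Sum>j<24. x j) + (\<Sum>j<24. y j)" for x y :: "nat \<Rightarrow> bit"
    by (simp only: plus_fun_apply sum.distrib)
  \<comment> \<open>The only binary scalars are 0 and 1, so closure under scaling follows from
    containing 0.\<close>
  have 3: "wscale a x = (if a = 0 then 0 else x)" for a and x :: "nat \<Rightarrow> bit"
    by (cases a) (auto simp: wscale_def fun_eq_iff)
  have zero: "0 \<in> extended_golay"
    by (simp add: extended_golay_def words_def)
  moreover have "x + y \<in> extended_golay" if "x \<in> extended_golay" "y \<in> extended_golay" for x y
  proof -
    have "x + y \<in> words 24"
      using that by (simp add: extended_golay_def word.subspace_add[OF subspace_words])
    then show ?thesis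
      using that unfolding extended_golay_def mem_Collect_eq 1 2 by (auto intro: dvd_add)
  qed
  ultimately show ?thesis
    by (simp add: word.subspace_def 3)
qed

lemma golay_row_in_extended_golay:
  assumes "i < 12"
  shows "golay_row i \<in> extended_golay"
proof -
  have "(\<Sum>j<23. Polynomial.monom (golay_row i j) j) = Polynomial.monom 1 i * golay_gen_poly"
  proof (rule poly_eqI)
    fix l
    \<comment> \<open>For \<open>i < 12\<close> the shifted generator has degree at most 22, so
      cutting off at 23 coordinates loses no coefficient.\<close>
    have "poly.coeff golay_gen_poly (l - i) = 0" if "23 \<le> l"
      using that assms by (intro coeff_eq_0) (simp add: degree_golay_gen_poly)
    then show "poly.coeff (\<Sum>j<23. Polynomial.monom (golay_row i j) j) l =
        poly.coeff (Polynomial.monom 1 i * golay_gen_poly) l"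
      by (simp add: coeff_sum coeff_monom_mult golay_row_def)
  qed
  \<comment> \<open>The parity check is phrased over lists so that it can be evaluated.\<close>
  moreover have "\<forall>i\<in>set [0..<12]. (\<Sum>j\<leftarrow>[0..<24]. golay_row i j) = 0"
    by code_simp
  then have "(\<Sum>j<24. golay_row i j) = 0"
    using assms by (simp add: sum_list_distinct_conv_sum_set atLeast0LessThan)
  moreover have "golay_row i \<in> words 24"
    by (simp add: words_def golay_row_def)
  ultimately show ?thesis
    by (simp add: extended_golay_def)
qed

text \<open>Dividing the polynomial of a codeword by the generator gives a quotient of degree at
  most 11, whose coefficients are the coefficients of the codeword with respect to the twelve
  rows.\<close>

lemma extended_golay_eq_span: "extended_golay = word.span (golay_row ` {..<12})"
proof
  show le: "word.span (golay_row ` {..<12}) \<subseteq> extended_golay"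
    by (intro word.span_minimal subspace_extended_golay) (auto simp: golay_row_in_extended_golay)
  show "extended_golay \<subseteq> word.span (golay_row ` {..<12})"
  proof
    fix x assume x: "x \<in> extended_golay"
    define p where "p = (\<Sum>j<23. Polynomial.monom (x j) j)"
    have coeff_p: "poly.coeff p j = (if j < 23 then x j else 0)" for j
      by (simp add: p_def coeff_sum if_distrib cong: if_cong)
    from x obtain q where q: "p = q * golay_gen_poly"
      by (auto simp: extended_golay_def p_def dvd_def mult.commute)
    have coeff_q: "poly.coeff q i = 0" if "12 \<le> i" for i
    proof (cases "q = 0")
      case False
      have "Polynomial.degree p \<le> 22"
        by (rule degree_le) (simp add: coeff_p)
      moreover have "Polynomial.degree p = Polynomial.degree q + 11"
        using False by (subst q, subst degree_mult_eq) (auto simp: degree_golay_gen_poly golay_gen_poly_def)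
      ultimately show ?thesis using that by (intro coeff_eq_0) simp
    qed simp
    define y where "y = (\<Sum>i<12. wscale (poly.coeff q i) (golay_row i))"
    have y: "y \<in> word.span (golay_row ` {..<12})"
      unfolding y_def by (intro word.span_sum word.span_scale word.span_base imageI)
    then have "x - y \<in> extended_golay"
      using x le by (intro word.subspace_diff subspace_extended_golay) auto
    moreover have xy: "(x - y) j = 0" if "j < 23" for j
    proof -
      have "x j = (\<Sum>i\<le>j. poly.coeff q i * poly.coeff golay_gen_poly (j - i))"
        using that coeff_p[of j] by (simp add: q coeff_mult)
      also have "\<dots> = (\<Sum>i<12. poly.coeff q i * golay_row i j)"
        using that by (intro sum.mono_neutral_cong) (auto simp: coeff_q golay_row_def)
      also have "\<dots> = y j"
        by (simp add: y_def wscale_def sum_apply)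
      finally show ?thesis by simp
    qed
    \<comment> \<open>The difference can only be nonzero at coordinate 23, where the parity check
      forces it to vanish as well.\<close>
    ultimately have "(\<Sum>j<24. (x - y) j) = 0" and "x - y \<in> words 24"
      by (simp_all only: extended_golay_def mem_Collect_eq)
    moreover have "(\<Sum>j<24. (x - y) j) = (\<Sum>j\<in>{23}. (x - y) j)"
      using xy by (intro sum.mono_neutral_right) auto
    moreover have "\<dots> = (x - y) 23"
      by (subst sum.insert) simp_all
    ultimately have "(x - y) 23 = 0" and "x - y \<in> words 24"
      by (simp_all only:)
    then have "(x - y) j = 0" for j
      using xy by (cases "j < 23"; cases "j = 23") (auto simp: words_def)
    then have "x - y = 0" by (simp add: fun_eq_iff)
    then show "x \<in> word.span (golay_row ` {..<12})" using y by simp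
  qed
qed

text \<open>The rows are in echelon form: row \<open>i\<close> starts at coordinate \<open>i\<close>
  with the constant coefficient 1 of the generator.\<close>

lemma dim_extended_golay: "word.dim extended_golay = 12"
proof -
  have "golay_row i i = 1" if "i < 12" for i
    using that by (simp add: golay_row_def golay_gen_poly_def)
  moreover have "golay_row k i = 0" if "k < 12" "i < k" for i k
    using that by (simp add: golay_row_def)
  ultimately have "word.independent (golay_row ` {..<12}) \<and> inj_on golay_row {..<12}"
    by (intro independent_triangular) auto
  then show ?thesis
    by (simp add: extended_golay_eq_span word.dim_span_eq_card_independent card_image
        del: word.dim_span)
qed

text \<open>Over the field with two elements, this tests \<open>P\<close> on all words of the coset of \<open>v\<close> modulo
  the span of a list of rows.\<close>

fun span_all :: "('a list \<Rightarrow> bool) \<Rightarrow> ('a::plus) list \<Rightarrow> 'a list list \<Rightarrow> bool" where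
  "span_all P v [] = P v"
| "span_all P v (r # rs) \<longleftrightarrow> span_all P v rs \<and> span_all P (map2 (+) v r) rs"

text \<open>A binary coefficient either omits \<open>r\<close> or adds it once, which gives the two
  branches of \<open>span_all\<close>. The offset \<open>v\<close> is generalized because the second
  branch continues from \<open>v + r\<close>.\<close>

lemma span_allD:
  fixes v x :: "nat \<Rightarrow> bit"
  assumes "span_all P (map v [0..<m]) (map (\<lambda>r. map r [0..<m]) rs)" "x \<in> word.span (set rs)"
  shows "P (map (v + x) [0..<m])"
  using assms
proof (induction rs arbitrary: v x)
  case (Cons r rs)
  from Cons.prems(2) obtain a where a: "x - wscale a r \<in> word.span (set rs)"
    by (auto simp: word.span_breakdown_eq)
  have "map2 (+) (map v [0..<m]) (map r [0..<m]) = map (v + r) [0..<m]"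
    by (intro nth_equalityI) auto
  with Cons.prems(1) have *: "span_all P (map v [0..<m]) (map (\<lambda>r. map r [0..<m]) rs)"
     "span_all P (map (v + r) [0..<m]) (map (\<lambda>r. map r [0..<m]) rs)"
    by (simp_all only: list.map span_all.simps)
  have "wscale a r = (if a = 0 then 0 else r)"
    by (cases a) (auto simp: wscale_def fun_eq_iff)
  moreover have "v + r + (x - r) = v + x" by simp
  ultimately show ?case
    using Cons.IH[OF *(1)] Cons.IH[OF *(2)] a by (metis diff_zero)
qed auto

text \<open>Exhaustive evaluation: starting from the zero word, the coset is the code itself, and
  the alternative \<open>w = 0\<close> accommodates the zero codeword.\<close>

lemma span_all_golay_row:
  "span_all (\<lambda>ys. let w = length (filter (\<lambda>b. b = 1) ys) in w = 0 \<or> 8 \<le> w)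
     (map 0 [0..<24]) (map (\<lambda>r. map r [0..<24]) (map golay_row [0..<12]))"
  by code_simp

section \<open>Weights and orthogonality in the Golay code\<close>

lemma hamming_dist_0_eq_length_filter:
  fixes x :: "nat \<Rightarrow> bit"
  shows "hamming_dist n x 0 = length (filter (\<lambda>b. b = 1) (map x [0..<n]))"
  by (simp add: hamming_dist_def length_filter_conv_card cong: conj_cong)

lemma extended_golay_weight:
  assumes "x \<in> extended_golay" "x \<noteq> 0"
  shows "8 \<le> hamming_dist 24 x 0"
proof -
  have "x \<in> word.span (set (map golay_row [0..<12]))"
    using assms(1) by (simp add: extended_golay_eq_span atLeast0LessThan)
  from span_allD[OF span_all_golay_row this]
  have "hamming_dist 24 x 0 = 0 \<or> 8 \<le> hamming_dist 24 x 0"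
    by (simp add: Let_def hamming_dist_0_eq_length_filter)
  moreover have "hamming_dist 24 x 0 \<noteq> 0"
  proof
    assume "hamming_dist 24 x 0 = 0"
    then have "x j = 0" if "j < 24" for j
      using that by (auto simp: hamming_dist_def)
    moreover have "x j = 0" if "24 \<le> j" for j
      using that assms(1) by (simp add: extended_golay_def words_def)
    ultimately have "x = 0"
      by (metis ext not_less zero_fun_apply)
    with assms(2) show False by simp
  qed
  ultimately show ?thesis by blast
qed

lemma hamming_dist_golay_row:
  assumes "i < 12"
  shows "hamming_dist 24 (golay_row i) 0 = 8"
proof -
  have "\<forall>i\<in>set [0..<12]. length (filter (\<lambda>b. b = 1) (map (golay_row i) [0..<24])) = 8"
    by code_simp
  then show ?thesis
    using assms by (simp add: hamming_dist_0_eq_length_filter)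
qed

text \<open>Pairs of rows are checked by evaluation; the words orthogonal to a fixed row form a
  subspace, so the check extends to the span. Hence every row is a dual codeword.\<close>

lemma golay_row_orthogonal:
  assumes "i < 12" "x \<in> extended_golay"
  shows "(\<Sum>j<24. golay_row i j * x j) = 0"
proof -
  have "\<forall>i\<in>set [0..<12]. \<forall>k\<in>set [0..<12]. (\<Sum>j\<leftarrow>[0..<24]. golay_row i j * golay_row k j) = 0"
    by code_simp
  then have "(\<Sum>j<24. golay_row i j * golay_row k j) = 0" if "k < 12" for k
    using assms that by (simp add: sum_list_distinct_conv_sum_set atLeast0LessThan)
  moreover have "word.subspace {x. (\<Sum>j<24. golay_row i j * x j) = 0}"
    unfolding word.subspace_def
    by (simp only: mem_Collect_eq zero_fun_apply plus_fun_apply distrib_left sum.distrib wscale_def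
        mult.left_commute[of "golay_row i _"] sum_distrib_left[symmetric]) simp
  ultimately have "word.span (golay_row ` {..<12}) \<subseteq> {x. (\<Sum>j<24. golay_row i j * x j) = 0}"
    by (intro word.span_minimal) auto
  then show ?thesis using assms(2) by (auto simp: extended_golay_eq_span)
qed

lemma is_lrc_extended_golay: "is_lrc 24 12 8 7 extended_golay"
proof -
  have row0: "golay_row 0 \<in> extended_golay" "golay_row 0 \<noteq> 0"
    using golay_row_in_extended_golay hamming_dist_golay_row[of 0]
    by (auto simp: hamming_dist_def)
  have zero: "0 \<in> extended_golay"
    by (rule word.subspace_0[OF subspace_extended_golay])
  \<comment> \<open>By linearity a distance between codewords is the weight of their
    difference.\<close>
  have "8 \<le> hamming_dist 24 x y" if "x \<in> extended_golay" "y \<in> extended_golay" "x \<noteq> y" for x y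
    using extended_golay_weight[of "x - y"] that
    by (metis hamming_dist_diff word.subspace_diff subspace_extended_golay eq_iff_diff_eq_0)
  then have "8 \<le> min_dist 24 extended_golay"
    using row0 zero by (intro le_min_dist)
  moreover have "min_dist 24 extended_golay \<le> 8"
    using min_dist_le_hamming_dist[of "golay_row 0" extended_golay 0 24] row0 zero
    by (simp add: hamming_dist_golay_row)
  ultimately have "is_code 24 12 8 extended_golay"
    using row0 subspace_extended_golay dim_extended_golay
    by (auto simp: is_code_def extended_golay_def)
  moreover have "has_locality 24 7 extended_golay"
  proof (rule has_localityI_dual)
    fix j :: nat assume "j < 24"
    \<comment> \<open>Every coordinate is covered by some row, a dual codeword of weight 8, that is
      \<open>Suc 7\<close>.\<close>
    have "\<forall>j\<in>set [0..<24]. \<exists>i\<in>set [0..<12]. golay_row i j = 1"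
      by code_simp
    with \<open>j < 24\<close> have "\<exists>i\<in>set [0..<12]. golay_row i j = 1"
      by (metis atLeastLessThan_iff atLeastLessThan_upt le0)
    then obtain i where "i < 12" "golay_row i j = 1"
      by auto
    then show "\<exists>w. w j \<noteq> 0 \<and> card {l. l < 24 \<and> w l \<noteq> 0} \<le> Suc 7 \<and>
        (\<forall>x\<in>extended_golay. (\<Sum>l<24. w l * x l) = 0)"
      using hamming_dist_golay_row[of i] golay_row_orthogonal[of i]
      by (intro exI[of _ "golay_row i"]) (simp add: hamming_dist_def)
  qed
  ultimately show ?thesis by (simp add: is_lrc_def)
qed

section \<open>Concatenated codes\<close>

abbreviation concat_word ::
    "nat \<Rightarrow> ('k::field \<Rightarrow> (nat \<Rightarrow> 'b::field)) \<Rightarrow> (nat \<Rightarrow> 'k) \<Rightarrow> nat \<Rightarrow> 'b" where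
  "concat_word m \<phi> c \<equiv> (\<lambda>j. \<phi> (c (j div m)) (j mod m))"

text \<open>The positions below \<open>m * n\<close> are regrouped into blocks; division of
  \<open>i * m + l\<close> by \<open>m\<close> recovers the block \<open>i\<close> and the inner
  position \<open>l\<close>.\<close>

lemma hamming_dist_concat_word:
  "hamming_dist (m * n) (concat_word m \<phi> x) (concat_word m \<phi> y) =
     (\<Sum>i<n. hamming_dist m (\<phi> (x i)) (\<phi> (y i)))"
proof -
  let ?f = "\<lambda>j. of_bool (concat_word m \<phi> x j \<noteq> concat_word m \<phi> y j) :: nat"
  have "(\<Sum>j<m * n. ?f j) = (\<Sum>i<n. sum ?f {i * m..<i * m + m})"
    by (simp only: sum.nat_group mult.commute)
  also have "\<dots> = (\<Sum>i<n. \<Sum>l<m. ?f (i * m + l))"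
    using sum.shift_bounds_nat_ivl[of ?f 0 _ m]
    by (simp add: sum.atLeastLessThan_shift_0[of _ "_ * m"] atLeast0LessThan)
  also have "\<dots> = (\<Sum>i<n. hamming_dist m (\<phi> (x i)) (\<phi> (y i)))"
    unfolding hamming_dist_eq_sum by (intro sum.cong refl) auto
  finally show ?thesis by (simp add: hamming_dist_eq_sum)
qed

text \<open>The dimension is read off from the number of codewords.\<close>

theorem is_lrc_concat_code:
  fixes e :: "'b::{field,finite} \<Rightarrow> 'k::{field,finite}"
  assumes inner: "is_lrc m k\<^sub>1 d\<^sub>1 r C\<^sub>1" and outer: "is_code n k\<^sub>2 d\<^sub>2 C\<^sub>2"
    and iso: "linear_iso_onto e \<phi> C\<^sub>1"
  shows "\<exists>D\<ge>d\<^sub>1 * d\<^sub>2. is_lrc (m * n) (k\<^sub>1 * k\<^sub>2) D r (concat_code m \<phi> C\<^sub>2)"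
proof -
  interpret \<phi>: Vector_Spaces.linear "\<lambda>a x. e a * x" wscale \<phi>
    using iso by (simp add: linear_iso_onto_def)
  have inj: "inj \<phi>" and range: "range \<phi> = C\<^sub>1"
    using iso by (auto simp: linear_iso_onto_def bij_betw_def)
  have C1: "C\<^sub>1 \<subseteq> words m" "word.subspace C\<^sub>1" "C\<^sub>1 \<noteq> {0}" "word.dim C\<^sub>1 = k\<^sub>1"
      "min_dist m C\<^sub>1 = d\<^sub>1" "has_locality m r C\<^sub>1"
    using inner by (auto simp: is_lrc_def is_code_def)
  have C2: "C\<^sub>2 \<subseteq> words n" "word.subspace C\<^sub>2" "C\<^sub>2 \<noteq> {0}" "word.dim C\<^sub>2 = k\<^sub>2"
      "min_dist n C\<^sub>2 = d\<^sub>2"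
    using outer by (auto simp: is_code_def)
  \<comment> \<open>Length 0 would leave only the zero word in the inner code. Positivity makes
    \<open>div m\<close> and \<open>mod m\<close> address blocks properly.\<close>
  have m: "0 < m"
  proof (rule ccontr)
    assume "\<not> 0 < m"
    then have "C\<^sub>1 \<subseteq> {0}" using C1(1) by (auto simp: words_def fun_eq_iff)
    then show False using C1(2,3) word.subspace_0 by blast
  qed
  let ?C = "concat_code m \<phi> C\<^sub>2"
  have sub: "?C \<subseteq> words (m * n)"
  proof
    fix x assume "x \<in> ?C"
    then obtain c where c: "c \<in> C\<^sub>2" "x = concat_word m \<phi> c" by (auto simp: concat_code_def)
    have "c (j div m) = 0" if "m * n \<le> j" for j
    proof -
      have "n \<le> j div m" using that m by (simp add: less_eq_div_iff_mult_less_eq mult.commute)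
      then show ?thesis using c(1) C2(1) by (auto simp: words_def)
    qed
    then show "x \<in> words (m * n)" by (simp add: words_def c(2))
  qed
  have subspace: "word.subspace ?C"
    unfolding word.subspace_def
  proof (intro conjI allI ballI)
    have "concat_word m \<phi> 0 = 0"
      by (simp add: fun_eq_iff)
    then show "0 \<in> ?C"
      unfolding concat_code_def using word.subspace_0[OF C2(2)] by (intro image_eqI[of _ _ 0]) simp_all
  next
    fix x y assume "x \<in> ?C" "y \<in> ?C"
    then obtain a b where ab: "a \<in> C\<^sub>2" "b \<in> C\<^sub>2" "x = concat_word m \<phi> a" "y = concat_word m \<phi> b"
      by (auto simp: concat_code_def)
    then have "x + y = concat_word m \<phi> (a + b)"
      by (simp add: \<phi>.add fun_eq_iff)
    then show "x + y \<in> ?C"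
      unfolding concat_code_def using word.subspace_add[OF C2(2) ab(1,2)] by (rule image_eqI)
  next
    fix s x assume "x \<in> ?C"
    then obtain a where a: "a \<in> C\<^sub>2" "x = concat_word m \<phi> a"
      by (auto simp: concat_code_def)
    \<comment> \<open>A small-field scalar \<open>s\<close> acts on the outer word as
      \<open>e s\<close>, under which the outer code is closed.\<close>
    then have "wscale s x = concat_word m \<phi> (wscale (e s) a)"
      by (simp add: \<phi>.scale fun_eq_iff wscale_def)
    then show "wscale s x \<in> ?C"
      unfolding concat_code_def using word.subspace_scale[OF C2(2) a(1)] by (rule image_eqI)
  qed
  have inj_concat: "inj (concat_word m \<phi>)"
  proof (rule injI)
    fix x y assume eq: "concat_word m \<phi> x = concat_word m \<phi> y"
    have "\<phi> (x i) = \<phi> (y i)" for i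
    proof
      fix l
      show "\<phi> (x i) l = \<phi> (y i) l"
      proof (cases "l < m")
        case True
        then show ?thesis using fun_cong[OF eq, of "m * i + l"] by simp
      next
        \<comment> \<open>Beyond the block length nothing can be read off from the concatenated
          word, but inner codewords vanish there.\<close>
        case False
        have "\<phi> z l = 0" for z
        proof -
          have "\<phi> z \<in> words m" using range C1(1) by blast
          then show ?thesis using False by (simp add: words_def)
        qed
        then show ?thesis by simp
      qed
    qed
    then show "x = y" using inj by (auto simp: inj_def)
  qed
  have dim: "word.dim ?C = k\<^sub>1 * k\<^sub>2"
  proof -
    have "CARD('b) ^ word.dim ?C = card ?C"
      using card_subspace[OF subspace] finite_subset[OF sub finite_words] by simp
    also have "\<dots> = card C\<^sub>2"
      unfolding concat_code_def using inj_concat by (simp add: card_image inj_on_subset)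
    also have "\<dots> = CARD('k) ^ k\<^sub>2"
      using card_subspace[OF C2(2)] finite_subset[OF C2(1) finite_words] C2(4) by simp
    also have "CARD('k) = CARD('b) ^ k\<^sub>1"
      using card_subspace[OF C1(2)] finite_subset[OF C1(1) finite_words] C1(4)
        card_image[OF inj] range by simp
    finally have "CARD('b) ^ word.dim ?C = CARD('b) ^ (k\<^sub>1 * k\<^sub>2)"
      by (simp add: power_mult)
    \<comment> \<open>A base of at least 2 allows the exponents to be compared.\<close>
    moreover have "card {0, 1 :: 'b} \<le> CARD('b)"
      by (rule card_mono) auto
    ultimately show ?thesis by (subst (asm) power_inject_exp) auto
  qed
  have dist: "d\<^sub>1 * d\<^sub>2 \<le> hamming_dist (m * n) x y" if xy: "x \<in> ?C" "y \<in> ?C" "x \<noteq> y" for x y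
  proof -
    obtain a b where ab: "a \<in> C\<^sub>2" "b \<in> C\<^sub>2" "x = concat_word m \<phi> a" "y = concat_word m \<phi> b"
      using xy by (auto simp: concat_code_def)
    have "d\<^sub>1 * d\<^sub>2 \<le> d\<^sub>1 * hamming_dist n a b"
      using min_dist_le_hamming_dist[of a C\<^sub>2 b n] ab xy(3) C2(5) by auto
    also have "\<dots> = (\<Sum>i<n. d\<^sub>1 * of_bool (a i \<noteq> b i))"
      by (simp only: hamming_dist_eq_sum sum_distrib_left)
    also have "\<dots> \<le> (\<Sum>i<n. hamming_dist m (\<phi> (a i)) (\<phi> (b i)))"
    proof (rule sum_mono)
      fix i
      \<comment> \<open>Different outer symbols have different images under the injective
        \<open>\<phi>\<close>, hence inner distance at least \<open>d\<^sub>1\<close>.\<close>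
      show "d\<^sub>1 * of_bool (a i \<noteq> b i) \<le> hamming_dist m (\<phi> (a i)) (\<phi> (b i))"
        using min_dist_le_hamming_dist[of "\<phi> (a i)" C\<^sub>1 "\<phi> (b i)" m] C1(5) range inj
        by (auto simp: inj_eq)
    qed
    also have "\<dots> = hamming_dist (m * n) x y"
      by (simp add: ab hamming_dist_concat_word)
    finally show ?thesis .
  qed
  obtain c where "c \<in> C\<^sub>2" "c \<noteq> 0" "0 \<in> C\<^sub>2"
    using subspace_nontrivialE[OF C2(2,3)] .
  then have c: "concat_word m \<phi> c \<in> ?C" "concat_word m \<phi> 0 \<in> ?C"
      "concat_word m \<phi> c \<noteq> concat_word m \<phi> 0"
    unfolding concat_code_def using injD[OF inj_concat, of c 0] by blast+
  then have "?C \<noteq> {0}" by (metis singletonD)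
  then have "is_code (m * n) (k\<^sub>1 * k\<^sub>2) (min_dist (m * n) ?C) ?C"
    using sub subspace dim by (simp add: is_code_def)
  moreover have "has_locality (m * n) r ?C"
    unfolding has_locality_def
  proof (intro allI impI)
    fix j assume j: "j < m * n"
    obtain R where R: "R \<subseteq> {..<m} - {j mod m}" "card R \<le> r"
      "\<And>x y. \<lbrakk>x \<in> C\<^sub>1; y \<in> C\<^sub>1; \<forall>l\<in>R. x l = y l\<rbrakk> \<Longrightarrow> x (j mod m) = y (j mod m)"
      using C1(6) m unfolding has_locality_def by (meson mod_less_divisor)
    \<comment> \<open>The inner repair set of \<open>j mod m\<close>, moved into the block that
      contains \<open>j\<close>.\<close>
    let ?R = "(\<lambda>l. m * (j div m) + l) ` R"
    have "j div m < n" using j by (simp add: less_mult_imp_div_less mult.commute)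
    have "m * (j div m) + l < m * n" if "l < m" for l
    proof -
      have "m * (j div m) + l < m * Suc (j div m)" using that by simp
      also have "\<dots> \<le> m * n" using \<open>j div m < n\<close> by (intro mult_le_mono2) simp
      finally show ?thesis .
    qed
    moreover have "m * (j div m) + l \<noteq> j" if "l \<noteq> j mod m" for l
      using that mult_div_mod_eq[of m j] by linarith
    ultimately have "?R \<subseteq> {..<m * n} - {j}" using R(1) by auto
    moreover have "card ?R \<le> r" using R(2) by (simp add: card_image)
    moreover have "x j = y j" if xy: "x \<in> ?C" "y \<in> ?C" "\<forall>l\<in>?R. x l = y l" for x y
    proof -
      obtain a b where ab: "x = concat_word m \<phi> a" "y = concat_word m \<phi> b"
        using xy by (auto simp: concat_code_def)
      have "\<phi> (a (j div m)) l = \<phi> (b (j div m)) l" if "l \<in> R" for l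
      proof -
        have "l < m" using that R(1) by auto
        moreover have "x (m * (j div m) + l) = y (m * (j div m) + l)" using xy(3) that by blast
        ultimately show ?thesis by (simp add: ab)
      qed
      then show ?thesis
        using R(3)[of "\<phi> (a (j div m))" "\<phi> (b (j div m))"] range by (auto simp: ab)
    qed
    ultimately show "\<exists>R\<subseteq>{..<m * n} - {j}. card R \<le> r \<and>
        (\<forall>x\<in>?C. \<forall>y\<in>?C. (\<forall>l\<in>R. x l = y l) \<longrightarrow> x j = y j)"
      by (intro exI[of _ ?R]) blast
  qed
  moreover have "d\<^sub>1 * d\<^sub>2 \<le> min_dist (m * n) ?C"
    using le_min_dist[OF c dist] .
  ultimately show ?thesis by (auto simp: is_lrc_def)
qed

section \<open>Asymptotic parameters of the binary family\<close>

instance bit :: finite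
proof
  have "(UNIV :: bit set) = {0, 1}" using bit.exhaust by blast
  then show "finite (UNIV :: bit set)" by (metis finite.emptyI finite.insertI)
qed

text \<open>The liminf lives in the extended reals; the limit \<open>l\<close> below and the bound
  \<open>B\<close> above exclude infinite values.\<close>

lemma liminf_real_between:
  fixes f g :: "nat \<Rightarrow> real"
  assumes "g \<longlonglongrightarrow> l" "\<And>i. g i \<le> f i" "\<And>i. f i \<le> B"
  obtains \<delta> where "liminf (\<lambda>i. ereal (f i)) = ereal \<delta>" "l \<le> \<delta>"
proof -
  have "ereal l = liminf (\<lambda>i. ereal (g i))"
    using assms(1) by (intro lim_imp_Liminf[symmetric]) auto
  also have "\<dots> \<le> liminf (\<lambda>i. ereal (f i))"
    using assms(2) by (intro Liminf_mono) auto
  finally have l: "ereal l \<le> liminf (\<lambda>i. ereal (f i))" .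
  have "liminf (\<lambda>i. ereal (f i)) \<le> liminf (\<lambda>i. ereal B)"
    using assms(3) by (intro Liminf_mono) auto
  then have "liminf (\<lambda>i. ereal (f i)) \<le> ereal B"
    by (simp add: Liminf_const)
  with l that show thesis
    by (cases "liminf (\<lambda>i. ereal (f i))") auto
qed

theorem proposition3p9:
  fixes F :: "nat \<Rightarrow> 'f ring"
    and \<iota> :: "nat \<Rightarrow> 'k::{field,finite} \<Rightarrow> 'f"
    and P :: "nat \<Rightarrow> nat \<Rightarrow> 'f set"
    and G :: "nat \<Rightarrow> 'f set \<Rightarrow> int"
    and n k d :: "nat \<Rightarrow> nat"
    and C_out :: "nat \<Rightarrow> (nat \<Rightarrow> 'k) set"
    and R_out \<delta>_out :: real
    and e :: "bit \<Rightarrow> 'k"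
    and \<phi> :: "nat \<Rightarrow> 'k \<Rightarrow> (nat \<Rightarrow> bit)"
    and C :: "nat \<Rightarrow> (nat \<Rightarrow> bit) set"
  assumes card_alphabet: "CARD('k) = 2 ^ 12"
    and ag: "\<And>i. ag_code_data (F i) (\<iota> i) (n i) (P i) (G i)"
    and C_out: "\<And>i. C_out i = ag_code (F i) (\<iota> i) (n i) (P i) (G i)"
    and params: "\<And>i. is_code (n i) (k i) (d i) (C_out i)"
    and lengths: "filterlim n at_top sequentially"
    and R_out: "(\<lambda>i. real (k i) / real (n i)) \<longlonglongrightarrow> R_out"
    and \<delta>_out: "(\<lambda>i. real (d i) / real (n i)) \<longlonglongrightarrow> \<delta>_out"
    and TVZ: "R_out \<ge> 1 - 1 / (2 ^ 6 - 1) - \<delta>_out"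
    and e: "e \<in> ring_hom field_ring field_ring"
    and \<phi>: "\<And>i. linear_iso_onto e (\<phi> i) extended_golay"
    and C: "\<And>i. C i = concat_code 24 (\<phi> i) (C_out i)"
  shows "is_lrc 24 12 8 7 extended_golay \<and>
    (\<forall>i. \<exists>D \<ge> 8 * d i. is_lrc (24 * n i) (12 * k i) D 7 (C i)) \<and>
    filterlim (\<lambda>i. 24 * n i) at_top sequentially \<and>
    (\<exists>R \<delta>. has_information_rate (\<lambda>i. 24 * n i) C R \<and>
           has_relative_min_dist (\<lambda>i. 24 * n i) C \<delta> \<and>
           R \<ge> 31 / 63 - 3 / 2 * \<delta>)"
proof -
  have lrc: "\<exists>D \<ge> 8 * d i. is_lrc (24 * n i) (12 * k i) D 7 (C i)" for i
    unfolding C by (rule is_lrc_concat_code[OF is_lrc_extended_golay params \<phi>])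
  \<comment> \<open>\<open>is_code\<close> fixes the minimum distance exactly, so the witness
    \<open>D\<close> is \<open>min_dist\<close> itself.\<close>
  then have code: "is_code (24 * n i) (12 * k i) (min_dist (24 * n i) (C i)) (C i)"
    and lower: "8 * d i \<le> min_dist (24 * n i) (C i)" for i
    unfolding is_lrc_def is_code_def by metis+
  then have dim: "word.dim (C i) = 12 * k i" and upper: "min_dist (24 * n i) (C i) \<le> 24 * n i" for i
    using min_dist_le_length[OF code] code by (simp_all add: is_code_def)
  have "(\<lambda>i. real (d i) / real (n i) / 3) \<longlonglongrightarrow> \<delta>_out / 3"
    using \<delta>_out by (intro tendsto_intros) auto
  moreover have "real (d i) / real (n i) / 3 \<le> real (min_dist (24 * n i) (C i)) / real (24 * n i)" for i
  proof -
    \<comment> \<open>The factor 1/3 is 8/24. The equation also covers \<open>n i = 0\<close>, since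
      division by zero yields 0.\<close>
    have "real (d i) / real (n i) / 3 = real (8 * d i) / real (24 * n i)"
      by simp
    also have "\<dots> \<le> real (min_dist (24 * n i) (C i)) / real (24 * n i)"
      using lower[of i] by (intro divide_right_mono of_nat_mono) auto
    finally show ?thesis .
  qed
  moreover have "real (min_dist (24 * n i) (C i)) / real (24 * n i) \<le> 1" for i
    using upper[of i] by (intro divide_le_eq_1[THEN iffD2]) linarith
  ultimately obtain \<delta> where \<delta>: "has_relative_min_dist (\<lambda>i. 24 * n i) C \<delta>" "\<delta>_out / 3 \<le> \<delta>"
    unfolding has_relative_min_dist_def by (rule liminf_real_between)
  have "(\<lambda>i. real (k i) / real (n i) / 2) \<longlonglongrightarrow> R_out / 2"
    using R_out by (intro tendsto_intros) auto
  moreover have "real (k i) / real (n i) / 2 = real (word.dim (C i)) / real (24 * n i)" for i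
    by (simp add: dim)
  ultimately have "has_information_rate (\<lambda>i. 24 * n i) C (R_out / 2)"
    by (simp only: has_information_rate_def)
  \<comment> \<open>Here \<open>1 / (2 ^ 6 - 1)\<close> is 1/63, and \<open>\<delta>_out\<close> is
    at most \<open>3 * \<delta>\<close>.\<close>
  moreover have "31 / 63 - 3 / 2 * \<delta> \<le> R_out / 2"
    using TVZ \<delta>(2) by simp
  moreover have "filterlim (\<lambda>i. 24 * n i) at_top sequentially"
    using lengths by (rule filterlim_at_top_mono) simp
  ultimately show ?thesis
    using is_lrc_extended_golay lrc \<delta>(1) by blast
qed

end
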